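(* Let $\varrho:L_d^\infty\to\mathbb{C}$ be a risk measure associated with $f$, let $\mathbb{F}=\{f(y): y\in\mathbb{R}^d\}$, let $\mathbb{A}=\{a\in\mathbb{C}: \mathbf{e}\preceq a\}$ be the acceptance cone, and put $\varrho_{\mathcal{A}}(X)=\{f(y): y\in\mathbb{R}^d,\ \varrho(X-y)\in\mathbb{A}\}$ for $X\in L_d^\infty$. If $\mathbb{F}$ is sup-generating, i.e. $$b=\bigvee\{a\in\mathbb{F}: a\preceq b\}\quad\text{for all } b\in\mathbb{C},$$ then $$\varrho(X)=\bigvee\varrho_{\mathcal{A}}(X)\quad\text{for all }X\in L_d^\infty.$$
   Context: $L_d^\infty$ is the set of essentially bounded $d$-dimensional random vectors on a probability space $(\Omega,\mathfrak{F},\mathbf{P})$; $\mathbb{R}^d$ is embedded in it as the constants. Convex cone: $\mathbb{C}$ is a topological space with a commutative, associative, continuous operation $\oplus$ with neutral element $\mathbf{e}$, and a continuous multiplication $(x,t)\mapsto t\odot x$ by scalars $t>0$ with $1\odot x=x$, $t\odot\mathbf{e}=\mathbf{e}$, $t\odot(x\oplus y)=t\odot x\oplus t\odot y$, $t\odot(s\odot x)=(ts)\odot x$. (No cancellation law and no law $t\odot x\oplus s\odot x=(t+s)\odot x$ is assumed.) $\mathbb{C}$ carries a partial order $\preceq$ such that $x\preceq y$ implies $x\oplus z\preceq y\oplus z$ for all $z$ and $t\odot x\preceq t\odot y$ for all $t>0$; with this order $\mathbb{C}$ is a complete lattice (supremum $\bigvee$, infimum $\bigwedge$), and its top element $\mathbb{T}$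 is absorbing: $\mathbb{T}\oplus a=\mathbb{T}$ for all $a$. $K\subsetneq\mathbb{R}^d$ is a proper Euclidean convex cone: $\mathbb{R}^d_+\subseteq K$, $K$ contains no line, and $x+y\in K$, $tx\in K$ for $x,y\in K$, $t>0$. Write $x\leq_K y$ iff $y-x\in K$. $f:\mathbb{R}^d\to\mathbb{C}$ satisfies $f(0)=\mathbf{e}$, $f(x)\oplus f(y)=f(x+y)$ for all $x,y$, and $f(y)\preceq f(x)$ whenever $y\leq_K x$. A functional $\varrho:L_d^\infty\to\mathbb{C}$ is a risk measure associated with $f$ if $\varrho(X)=f(x)$ whenever $X=x$ a.s., and (R1) $f(y)\oplus\varrho(X)=\varrho(X+y)$ for all $y\in\mathbb{R}^d$; (R2) $\varrho(Y)\preceq\varrho(X)$ whenever $Y\leq_K X$ a.s. The set $\mathcal{A}=\{X\in L_d^\infty:\varrho(X)\in\mathbb{A}\}$ is called the acceptance set of $\varrho$, so that $\varrho_{\mathcal{A}}(X)=\{f(y): X-y\in\mathcal{A}\}$. *)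

theory Defs
  imports "HOL-Probability.Probability"
begin

text \<open>
  The cone operations are written additively: \<open>x + y\<close>, \<open>0\<close> and \<open>t *\<^sub>R x\<close> stand for
  \<open>x \<oplus> y\<close>, \<open>\<^bold>e\<close> and \<open>t \<odot> x\<close>. The superclasses give a commutative monoid with continuous
  addition that is monotone in each argument. The first axiom is joint continuity of the scaling
  on \<open>{0<..} \<times> UNIV\<close>: this set is open, and \<open>nhds t \<times>\<^sub>F nhds x\<close> is the neighbourhood filter of
  \<open>(t, x)\<close> in the product topology. Neither cancellation nor a law relating
  \<open>t *\<^sub>R x + s *\<^sub>R x\<close> to \<open>(t + s) *\<^sub>R x\<close> is included. Scalars \<open>t \<le> 0\<close> are left unspecified,
  and the topology is not assumed to be the order topology.
\<close>

class lattice_convex_cone =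
  topological_comm_monoid_add + ordered_comm_monoid_add + complete_lattice + scaleR +
  assumes tendsto_cone_scale_Pair:
      "0 < t \<Longrightarrow> LIM z (nhds t \<times>\<^sub>F nhds x). fst z *\<^sub>R snd z :> nhds (t *\<^sub>R x)"
    and cone_scale_one: "1 *\<^sub>R x = x"
    and cone_scale_zero: "0 < t \<Longrightarrow> t *\<^sub>R 0 = 0"
    and cone_scale_add: "0 < t \<Longrightarrow> t *\<^sub>R (x + y) = t *\<^sub>R x + t *\<^sub>R y"
    and cone_scale_scale: "0 < t \<Longrightarrow> 0 < s \<Longrightarrow> t *\<^sub>R (s *\<^sub>R x) = (t * s) *\<^sub>R x"
    and cone_scale_mono: "0 < t \<Longrightarrow> x \<le> y \<Longrightarrow> t *\<^sub>R x \<le> t *\<^sub>R y"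
    and cone_top_absorbing: "top + x = top"

definition proper_euclidean_cone :: "(real ^ 'd) set \<Rightarrow> bool" where
  "proper_euclidean_cone K \<longleftrightarrow>
     K \<subset> UNIV \<and>
     {x. \<forall>i. 0 \<le> x $ i} \<subseteq> K \<and>
     \<not> (\<exists>x v. v \<noteq> 0 \<and> (\<forall>t. x + t *\<^sub>R v \<in> K)) \<and>
     (\<forall>x\<in>K. \<forall>y\<in>K. x + y \<in> K) \<and>
     (\<forall>x\<in>K. \<forall>t>0. t *\<^sub>R x \<in> K)"

definition cone_le :: "(real ^ 'd) set \<Rightarrow> real ^ 'd \<Rightarrow> real ^ 'd \<Rightarrow> bool" where
  "cone_le K x y \<longleftrightarrow> y - x \<in> K"

definition monotone_cone_hom :: "(real ^ 'd) set \<Rightarrow> (real ^ 'd \<Rightarrow> 'c::lattice_convex_cone) \<Rightarrow> bool" where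
  "monotone_cone_hom K f \<longleftrightarrow>
     f 0 = 0 \<and>
     (\<forall>x y. f x + f y = f (x + y)) \<and>
     (\<forall>x y. cone_le K y x \<longrightarrow> f y \<le> f x)"

text \<open>
  Random vectors are functions rather than classes of almost surely equal functions. Since
  \<open>0 \<in> K\<close>, a monotone functional (condition R2 below) takes equal values at almost surely equal
  random vectors, so it is the same thing as a functional on the classes.
\<close>

definition Linfty :: "'w measure \<Rightarrow> ('w \<Rightarrow> real ^ 'd) set" where
  "Linfty M = {X \<in> borel_measurable M. \<exists>B. AE \<omega> in M. norm (X \<omega>) \<le> B}"

definition risk_measure ::
  "'w measure \<Rightarrow> (real ^ 'd) set \<Rightarrow> (real ^ 'd \<Rightarrow> 'c::lattice_convex_cone) \<Rightarrow>
   (('w \<Rightarrow> real ^ 'd) \<Rightarrow> 'c) \<Rightarrow> bool" where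
  "risk_measure M K f \<rho> \<longleftrightarrow>
     (\<forall>X\<in>Linfty M. \<forall>x. (AE \<omega> in M. X \<omega> = x) \<longrightarrow> \<rho> X = f x) \<and>
     (\<forall>X\<in>Linfty M. \<forall>y. f y + \<rho> X = \<rho> (\<lambda>\<omega>. X \<omega> + y)) \<and>
     (\<forall>X\<in>Linfty M. \<forall>Y\<in>Linfty M. (AE \<omega> in M. cone_le K (Y \<omega>) (X \<omega>)) \<longrightarrow> \<rho> Y \<le> \<rho> X)"

definition acceptance_cone :: "'c::lattice_convex_cone set" where
  "acceptance_cone = {a. 0 \<le> a}"

definition acceptance_values ::
  "(real ^ 'd \<Rightarrow> 'c::lattice_convex_cone) \<Rightarrow> (('w \<Rightarrow> real ^ 'd) \<Rightarrow> 'c) \<Rightarrow>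
   ('w \<Rightarrow> real ^ 'd) \<Rightarrow> 'c set" where
  "acceptance_values f \<rho> X = {f y | y. \<rho> (\<lambda>\<omega>. X \<omega> - y) \<in> acceptance_cone}"

definition sup_generating :: "'c::complete_lattice set \<Rightarrow> bool" where
  "sup_generating F \<longleftrightarrow> (\<forall>b. b = Sup {a \<in> F. a \<le> b})"

end

theory Submission imports Defs begin

text \<open>
  Each value \<open>f y\<close> is invertible with inverse \<open>f (- y)\<close>, so translating by \<open>f (- y)\<close> preserves
  and reflects the order even though the cone has no cancellation law. Hence
  \<open>0 \<le> \<rho> (X - y) = f (- y) + \<rho> X\<close> holds iff \<open>f y \<le> \<rho> X\<close>, and the acceptance values of \<open>X\<close> are
  precisely the elements of \<open>range f\<close> below \<open>\<rho> X\<close>.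
\<close>

lemma zero_le_add_iff_of_inverse:
  fixes a b c :: "'a::ordered_comm_monoid_add"
  assumes "a + b = 0"
  shows "0 \<le> b + c \<longleftrightarrow> a \<le> c"
proof
  assume "0 \<le> b + c"
  \<comment> \<open>Adding \<open>a\<close> undoes \<open>b\<close>, which replaces the missing
    cancellation law; the converse adds \<open>b\<close> to undo \<open>a\<close>.\<close>
  then have "a + 0 \<le> a + (b + c)"
    by (rule add_left_mono)
  also have "\<dots> = c"
    by (simp add: assms add.assoc[symmetric])
  finally show "a \<le> c" by simp
next
  assume "a \<le> c"
  then have "b + a \<le> b + c"
    by (rule add_left_mono)
  then show "0 \<le> b + c"
    by (simp add: assms add.commute[of b a])
qed

lemma monotone_cone_hom_inverse:
  assumes "monotone_cone_hom K f"
  shows "f y + f (- y) = 0"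
  using assms by (simp add: monotone_cone_hom_def)

lemma risk_measure_minus_const:
  assumes "risk_measure M K f \<rho>" and "X \<in> Linfty M"
  shows "\<rho> (\<lambda>\<omega>. X \<omega> - y) = f (- y) + \<rho> X"
proof -
  \<comment> \<open>This is R1 for the constant \<open>- y\<close>.\<close>
  have "f (- y) + \<rho> X = \<rho> (\<lambda>\<omega>. X \<omega> + - y)"
    using assms unfolding risk_measure_def by blast
  then show ?thesis by simp
qed

lemma acceptance_values_eq:
  assumes "monotone_cone_hom K f" and "risk_measure M K f \<rho>" and "X \<in> Linfty M"
  shows "acceptance_values f \<rho> X = {a \<in> range f. a \<le> \<rho> X}"
  \<comment> \<open>The order equivalence is used with \<open>a = f y\<close>,
    \<open>b = f (- y)\<close> and \<open>c = \<rho> X\<close>.\<close>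
  by (auto simp: acceptance_values_def acceptance_cone_def risk_measure_minus_const[OF assms(2,3)]
      zero_le_add_iff_of_inverse[OF monotone_cone_hom_inverse[OF assms(1)]])

theorem proposition3p1:
  fixes M :: "'w measure"
    and K :: "(real ^ 'd) set"
    and f :: "real ^ 'd \<Rightarrow> 'c::lattice_convex_cone"
    and \<rho> :: "('w \<Rightarrow> real ^ 'd) \<Rightarrow> 'c"
  assumes "prob_space M"
    and "proper_euclidean_cone K"
    and "monotone_cone_hom K f"
    and "risk_measure M K f \<rho>"
    and "sup_generating (range f)"
  shows "\<forall>X\<in>Linfty M. \<rho> X = Sup (acceptance_values f \<rho> X)"
proof
  fix X :: "'w \<Rightarrow> real ^ 'd"
  assume "X \<in> Linfty M"
  with assms(3,4) have "acceptance_values f \<rho> X = {a \<in> range f. a \<le> \<rho> X}"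
    by (rule acceptance_values_eq)
  \<comment> \<open>Sup-generation is needed only at the single element
    \<open>b = \<rho> X\<close>.\<close>
  with assms(5) show "\<rho> X = Sup (acceptance_values f \<rho> X)"
    unfolding sup_generating_def by metis
qed

end
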